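(* Let $C$ be a stratum of $G$. If $g,g'\in C$, then the identity components $Z_G(g)^0$ and $Z_G(g')^0$ are conjugate under $G^0$.
   Context: $\mathbf k$ is an algebraically closed field; all algebraic groups are affine and over $\mathbf k$. An algebraic group is called reductive if its identity component is reductive (it need not be connected). $G$ is a reductive algebraic group, with identity component $G^0$. For an algebraic group $H$: $\mathcal Z_H$ is the centre of $H$, $H^0$ the identity component, $\mathcal Z_H^0$ the identity component of $\mathcal Z_H$, $Z_H(h)$ the centralizer of $h$ in $H$, and $h=h_sh_u=h_uh_s$ the Jordan decomposition ($h_s$ semisimple, $h_u$ unipotent). For $g\in G$ the group $Z_G(g_s)^0$ is reductive; put $T(g)=(\mathcal Z_{Z_G(g_s)^0}\cap Z_G(g_u))^0$, a torus. For $g,g'\in G$ write $g\sim g'$ if $T(g)=T(g')$ and $g'g^{-1}\in T(g)$. Write $g\asymp g'$ if $xgx^{-1}\sim g'$ for some $x\in G^0$. Both are equivalence relations on $G$. The equivalence classes of $\asymp$ are called the strata of $G$. *)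

theory Defs
  imports
    "HOL-Algebra.Coset"
    "HOL-Analysis.Abstract_Topology_2"
    "HOL-Computational_Algebra.Polynomial"
begin

text \<open>
  Affine algebraic groups over an algebraically closed field are treated classically and without
  a choice of embedding: such a group is an abstract group together with its algebra of regular
  functions. A \<open>'k\<close>-valued function on a set \<open>X\<close> is encoded as a total function that vanishes
  outside \<open>X\<close>, so that equality of functions on \<open>X\<close> is equality in HOL.
\<close>

subsection \<open>Affine varieties\<close>

inductive_set generated_algebra :: "'a set \<Rightarrow> ('a \<Rightarrow> 'k::field) set \<Rightarrow> ('a \<Rightarrow> 'k) set"
  for X :: "'a set" and S :: "('a \<Rightarrow> 'k) set" where
  const: "(\<lambda>x. if x \<in> X then c else 0) \<in> generated_algebra X S"
| gen: "f \<in> S \<Longrightarrow> f \<in> generated_algebra X S"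
| add: "f \<in> generated_algebra X S \<Longrightarrow> g \<in> generated_algebra X S \<Longrightarrow>
    (\<lambda>x. f x + g x) \<in> generated_algebra X S"
| mult: "f \<in> generated_algebra X S \<Longrightarrow> g \<in> generated_algebra X S \<Longrightarrow>
    (\<lambda>x. f x * g x) \<in> generated_algebra X S"

definition algebra_character :: "'a set \<Rightarrow> ('a \<Rightarrow> 'k::field) set \<Rightarrow> (('a \<Rightarrow> 'k) \<Rightarrow> 'k) \<Rightarrow> bool" where
  "algebra_character X A \<phi> \<longleftrightarrow>
     \<phi> (\<lambda>x. if x \<in> X then 1 else 0) = 1 \<and>
     (\<forall>f\<in>A. \<forall>g\<in>A. \<phi> (\<lambda>x. f x + g x) = \<phi> f + \<phi> g) \<and>
     (\<forall>f\<in>A. \<forall>g\<in>A. \<phi> (\<lambda>x. f x * g x) = \<phi> f * \<phi> g) \<and>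
     (\<forall>c. \<forall>f\<in>A. \<phi> (\<lambda>x. c * f x) = c * \<phi> f)"

text \<open>
  \<open>(X, A)\<close> is an affine variety with coordinate ring \<open>A\<close>: the algebra \<open>A\<close> of functions (which is
  automatically reduced) is finitely generated, and evaluation identifies \<open>X\<close> with the set of
  algebra homomorphisms from \<open>A\<close> to the base field.
\<close>

definition affine_variety :: "'a set \<Rightarrow> ('a \<Rightarrow> 'k::field) set \<Rightarrow> bool" where
  "affine_variety X A \<longleftrightarrow>
     (\<exists>S. finite S \<and> (\<forall>f\<in>S. \<forall>x. x \<notin> X \<longrightarrow> f x = 0) \<and> A = generated_algebra X S) \<and>
     (\<forall>\<phi>. algebra_character X A \<phi> \<longrightarrow> (\<exists>!x. x \<in> X \<and> (\<forall>f\<in>A. \<phi> f = f x)))"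

subsection \<open>Affine algebraic groups\<close>

record ('a, 'k) alg_group = "'a monoid" +
  regular :: "('a \<Rightarrow> 'k) set"

text \<open>
  The second condition says that the multiplication is a morphism of varieties: composition with
  it maps \<open>regular G\<close> into the coordinate ring of the product variety, that is, the tensor square
  of \<open>regular G\<close>, regarded as functions of two variables.
\<close>

locale algebraic_group = group G
  for G :: "('a, 'k::alg_closed_field) alg_group" (structure) +
  assumes variety: "affine_variety (carrier G) (regular G)"
    and mult_morphism: "f \<in> regular G \<Longrightarrow>
      \<exists>(n::nat) p q. (\<forall>i<n. p i \<in> regular G \<and> q i \<in> regular G) \<and>
        (\<forall>x\<in>carrier G. \<forall>y\<in>carrier G. f (x \<otimes> y) = (\<Sum>i<n. p i x * q i y))"
    and inv_morphism: "f \<in> regular G \<Longrightarrow>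
      (\<lambda>x. if x \<in> carrier G then f (inv x) else 0) \<in> regular G"

subsection \<open>The Zariski topology and identity components\<close>

definition zariski_open :: "('a, 'k::field) alg_group \<Rightarrow> 'a set \<Rightarrow> bool" where
  "zariski_open G U \<longleftrightarrow> (\<exists>F \<subseteq> regular G. U = {x \<in> carrier G. \<exists>f\<in>F. f x \<noteq> 0})"

definition zariski :: "('a, 'k::field) alg_group \<Rightarrow> 'a topology" where
  "zariski G = topology (zariski_open G)"

lemma istopology_zariski_open:
  assumes "algebraic_group G"
  shows "istopology (zariski_open G)"
proof -
  obtain S where S: "regular G = generated_algebra (carrier G) S"
    using algebraic_group.variety[OF assms] unfolding affine_variety_def by blast
  have "zariski_open G (U \<inter> V)" if U: "zariski_open G U" and V: "zariski_open G V" for U V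
  proof -
    obtain F where F: "F \<subseteq> regular G" "U = {x \<in> carrier G. \<exists>f\<in>F. f x \<noteq> 0}"
      using U unfolding zariski_open_def by blast
    obtain F' where F': "F' \<subseteq> regular G" "V = {x \<in> carrier G. \<exists>f\<in>F'. f x \<noteq> 0}"
      using V unfolding zariski_open_def by blast
    define P where "P = (\<lambda>(f, g) x. f x * g x) ` (F \<times> F')"
    have "P \<subseteq> regular G"
      using F(1) F'(1) unfolding S P_def by (force intro: generated_algebra.mult)
    moreover have "U \<inter> V = {x \<in> carrier G. \<exists>h\<in>P. h x \<noteq> 0}"
      unfolding F(2) F'(2) P_def by (simp add: set_eq_iff) blast
    ultimately show ?thesis
      unfolding zariski_open_def by (intro exI[of _ P] conjI)
  qed
  moreover have "zariski_open G (\<Union>\<K>)" if K: "\<forall>U\<in>\<K>. zariski_open G U" for \<K>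
  proof -
    define F where "F = {f \<in> regular G. {x \<in> carrier G. f x \<noteq> 0} \<subseteq> \<Union>\<K>}"
    have "x \<in> carrier G \<and> (\<exists>f\<in>F. f x \<noteq> 0)" if "U \<in> \<K>" and "x \<in> U" for x U
    proof -
      have "zariski_open G U"
        using K that(1) by blast
      then obtain F' where F': "F' \<subseteq> regular G" "U = {x \<in> carrier G. \<exists>f\<in>F'. f x \<noteq> 0}"
        unfolding zariski_open_def by blast
      then have "F' \<subseteq> F"
        using that(1) unfolding F_def by blast
      then show ?thesis
        using F'(2) that(2) by blast
    qed
    then have "\<Union>\<K> = {x \<in> carrier G. \<exists>f\<in>F. f x \<noteq> 0}"
      unfolding F_def by blast
    moreover have "F \<subseteq> regular G"
      unfolding F_def by blast
    ultimately show ?thesis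
      unfolding zariski_open_def by (intro exI[of _ F] conjI)
  qed
  ultimately show ?thesis
    unfolding istopology_def by blast
qed

lemma openin_zariski:
  "algebraic_group G \<Longrightarrow> openin (zariski G) U \<longleftrightarrow> zariski_open G U"
  unfolding zariski_def using topology_inverse'[OF istopology_zariski_open] by metis

text \<open>
  For a closed subgroup \<open>H\<close> of \<open>G\<close> the subspace topology is the Zariski topology of \<open>H\<close>, so this is
  the identity component of the algebraic group \<open>H\<close>.
\<close>

definition identity_component :: "('a, 'k::field) alg_group \<Rightarrow> 'a set \<Rightarrow> 'a set" where
  "identity_component G H = connected_component_of_set (subtopology (zariski G) H) \<one>\<^bsub>G\<^esub>"

subsection \<open>Jordan decomposition\<close>

definition right_translation ::
    "('a, 'k::field) alg_group \<Rightarrow> 'a \<Rightarrow> ('a \<Rightarrow> 'k) \<Rightarrow> 'a \<Rightarrow> 'k" where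
  "right_translation G g f = (\<lambda>x. if x \<in> carrier G then f (x \<otimes>\<^bsub>G\<^esub> g) else 0)"

text \<open>
  Right translations are locally finite operators on \<open>regular G\<close>. An element is semisimple
  (unipotent) if its right translation is, where a locally finite operator over an algebraically
  closed field is semisimple if the eigenvectors span the space, and unipotent if it differs from
  the identity by a locally nilpotent operator.
\<close>

definition semisimple :: "('a, 'k::field) alg_group \<Rightarrow> 'a \<Rightarrow> bool" where
  "semisimple G g \<longleftrightarrow> g \<in> carrier G \<and>
     (\<forall>f\<in>regular G. \<exists>E. finite E \<and>
        (\<forall>e\<in>E. e \<in> regular G \<and> (\<exists>c. right_translation G g e = (\<lambda>x. c * e x))) \<and>
        f = (\<lambda>x. \<Sum>e\<in>E. e x))"

definition unipotent :: "('a, 'k::field) alg_group \<Rightarrow> 'a \<Rightarrow> bool" where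
  "unipotent G g \<longleftrightarrow> g \<in> carrier G \<and>
     (\<forall>f\<in>regular G. \<exists>n. ((\<lambda>h x. right_translation G g h x - h x) ^^ n) f = (\<lambda>x. 0))"

definition jordan_decomposition :: "('a, 'k::field) alg_group \<Rightarrow> 'a \<Rightarrow> 'a \<times> 'a \<Rightarrow> bool" where
  "jordan_decomposition G g = (\<lambda>(s, u). semisimple G s \<and> unipotent G u \<and>
     g = s \<otimes>\<^bsub>G\<^esub> u \<and> g = u \<otimes>\<^bsub>G\<^esub> s)"

definition semisimple_part :: "('a, 'k::field) alg_group \<Rightarrow> 'a \<Rightarrow> 'a" where
  "semisimple_part G g = fst (THE p. jordan_decomposition G g p)"

definition unipotent_part :: "('a, 'k::field) alg_group \<Rightarrow> 'a \<Rightarrow> 'a" where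
  "unipotent_part G g = snd (THE p. jordan_decomposition G g p)"

subsection \<open>Reductive groups\<close>

text \<open>
  The unipotent radical of a closed subgroup \<open>H\<close> is its largest closed connected normal unipotent
  subgroup. Unipotency, closedness and connectedness of subgroups of \<open>H\<close> may be tested in \<open>G\<close>.
\<close>

definition unipotent_radical :: "('a, 'k::field) alg_group \<Rightarrow> 'a set \<Rightarrow> 'a set" where
  "unipotent_radical G H = \<Union> {U. U \<lhd> (G\<lparr>carrier := H\<rparr>) \<and> closedin (zariski G) U \<and>
     connectedin (zariski G) U \<and> (\<forall>u\<in>U. unipotent G u)}"

locale reductive_group = algebraic_group +
  assumes reductive: "unipotent_radical G (identity_component G (carrier G)) = {\<one>}"

subsection \<open>Strata\<close>

definition centralizer :: "('a, 'm) monoid_scheme \<Rightarrow> 'a \<Rightarrow> 'a set" where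
  "centralizer G g = {x \<in> carrier G. x \<otimes>\<^bsub>G\<^esub> g = g \<otimes>\<^bsub>G\<^esub> x}"

definition centre :: "('a, 'm) monoid_scheme \<Rightarrow> 'a set \<Rightarrow> 'a set" where
  "centre G H = {z \<in> H. \<forall>h\<in>H. z \<otimes>\<^bsub>G\<^esub> h = h \<otimes>\<^bsub>G\<^esub> z}"

definition stratum_torus :: "('a, 'k::field) alg_group \<Rightarrow> 'a \<Rightarrow> 'a set" where
  "stratum_torus G g = identity_component G
     (centre G (identity_component G (centralizer G (semisimple_part G g))) \<inter>
      centralizer G (unipotent_part G g))"

definition torus_equiv :: "('a, 'k::field) alg_group \<Rightarrow> 'a \<Rightarrow> 'a \<Rightarrow> bool" where
  "torus_equiv G g g' \<longleftrightarrow> stratum_torus G g = stratum_torus G g' \<and>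
     g' \<otimes>\<^bsub>G\<^esub> inv\<^bsub>G\<^esub> g \<in> stratum_torus G g"

definition stratum_rel :: "('a, 'k::field) alg_group \<Rightarrow> ('a \<times> 'a) set" where
  "stratum_rel G = {(g, g'). g \<in> carrier G \<and> g' \<in> carrier G \<and>
     (\<exists>x\<in>identity_component G (carrier G). torus_equiv G (x \<otimes>\<^bsub>G\<^esub> g \<otimes>\<^bsub>G\<^esub> inv\<^bsub>G\<^esub> x) g')}"

definition strata :: "('a, 'k::field) alg_group \<Rightarrow> 'a set set" where
  "strata G = carrier G // stratum_rel G"

definition conjugate_under :: "('a, 'm) monoid_scheme \<Rightarrow> 'a set \<Rightarrow> 'a set \<Rightarrow> 'a set \<Rightarrow> bool" where
  "conjugate_under G K A B \<longleftrightarrow> (\<exists>x\<in>K. B = (\<lambda>a. x \<otimes>\<^bsub>G\<^esub> a \<otimes>\<^bsub>G\<^esub> inv\<^bsub>G\<^esub> x) ` A)"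

end

theory Submission
  imports Defs "HOL-Library.Function_Algebras"
begin

text \<open>
  Suppose \<open>g' = t g\<close> with \<open>t \<in> T(g) = T(g')\<close>. The group \<open>Z(g)\<^sup>0\<close> is contained in
  \<open>Z(g\<^sub>s)\<^sup>0\<close>, whose centre contains \<open>t\<close>. Hence \<open>Z(g)\<^sup>0\<close> commutes with \<open>t g = g'\<close>, and being
  connected it lies in \<open>Z(g')\<^sup>0\<close>; by symmetry the two groups are equal. Conjugation by an element of
  \<open>G\<^sup>0\<close> is a homeomorphism that carries centralizers to centralizers.

  The inclusion \<open>Z(g) \<subseteq> Z(g\<^sub>s)\<close> rests on the existence and uniqueness of the Jordan decomposition.
  Right translation by \<open>g\<close> is locally finite on the coordinate ring, which is therefore the direct
  sum of its generalized eigenspaces. The operator acting as the scalar \<open>c\<close> on the generalized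
  eigenspace of \<open>c\<close> is an algebra endomorphism commuting with left translations; composed with
  evaluation at \<open>1\<close> it is a character, that is, a point of \<open>G\<close>, and this point is \<open>g\<^sub>s\<close>.
\<close>

subsection \<open>Semisimple part of a locally finite operator\<close>

text \<open>The space of interest is a subspace \<open>A\<close> of the type, because coordinate
  rings are subspaces of the space of all functions. Linearity of \<open>T\<close> is asked on the
  whole type, stability and local finiteness on \<open>A\<close>.\<close>

locale locally_finite_operator = vector_space scale
  for scale :: "'k::alg_closed_field \<Rightarrow> 'v::ab_group_add \<Rightarrow> 'v" (infixr \<open>*s\<close> 75) +
  fixes T :: "'v \<Rightarrow> 'v" and A :: "'v set"
  assumes T_add: "T (v + w) = T v + T w"
    and T_scale: "T (c *s v) = c *s T v"
    and subspace_A: "subspace A"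
    and T_stable: "v \<in> A \<Longrightarrow> T v \<in> A"
    and locally_finite: "v \<in> A \<Longrightarrow> \<exists>B. finite B \<and> (\<forall>i. (T ^^ i) v \<in> span B)"
begin

sublocale T: module_hom scale scale T
  by unfold_locales (auto simp: T_add T_scale)

section \<open>Generalized eigenspaces and their independence\<close>

definition shift :: "'k \<Rightarrow> 'v \<Rightarrow> 'v" where
  "shift c v = T v - c *s v"

definition geigen :: "'k \<Rightarrow> 'v set" where
  "geigen c = {v \<in> A. \<exists>n. (shift c ^^ n) v = 0}"

lemma shift_add: "shift c (v + w) = shift c v + shift c w"
  by (simp add: shift_def T_add scale_right_distrib)

lemma shift_scale: "shift c (a *s v) = a *s shift c v"
  by (simp add: shift_def T_scale scale_right_diff_distrib mult.commute)

sublocale shift: module_hom scale scale "shift c" for c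
  by unfold_locales (auto simp: shift_add shift_scale)

lemma shift_funpow_Suc: "(shift c ^^ Suc n) v = (shift c ^^ n) (shift c v)"
  by (simp only: funpow_Suc_right o_apply)

lemma shift_funpow_hom: "module_hom scale scale (shift c ^^ n)"
proof (induction n)
  case 0
  show ?case by unfold_locales auto
next
  case (Suc n)
  then interpret N: module_hom scale scale "shift c ^^ n" .
  show ?case by unfold_locales (auto simp: N.add N.scale shift_add shift_scale)
qed

lemmas shift_funpow_zero [simp] = module_hom.zero[OF shift_funpow_hom]
  and shift_funpow_add = module_hom.add[OF shift_funpow_hom]
  and shift_funpow_scale = module_hom.scale[OF shift_funpow_hom]
  and shift_funpow_sum = module_hom.sum[OF shift_funpow_hom]

lemma shift_stable: "v \<in> A \<Longrightarrow> shift c v \<in> A"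
  unfolding shift_def by (intro subspace_diff subspace_scale subspace_A T_stable)

lemma shift_commute: "shift c (shift d v) = shift d (shift c v)"
  by (simp add: shift_def T.diff T_scale scale_right_diff_distrib mult.commute)

lemma shift_funpow_commute:
  assumes "\<And>v. N (shift c v) = shift c (N v)"
  shows "N ((shift c ^^ n) v) = (shift c ^^ n) (N v)"
  by (induction n) (auto simp: assms)

lemma geigen_subset: "geigen c \<subseteq> A"
  by (auto simp: geigen_def)

lemma zero_in_geigen: "0 \<in> geigen c"
  using subspace_0[OF subspace_A] by (auto simp: geigen_def intro!: exI[of _ 0])

lemma subspace_geigen: "subspace (geigen c)"
proof (rule subspaceI)
  show "0 \<in> geigen c" by (rule zero_in_geigen)
next
  fix v w assume "v \<in> geigen c" "w \<in> geigen c"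
  then obtain m n where mn: "(shift c ^^ m) v = 0" "(shift c ^^ n) w = 0" "v \<in> A" "w \<in> A"
    by (auto simp: geigen_def)
  have "(shift c ^^ (n + m)) v = 0"
    by (simp only: funpow_add o_apply mn shift_funpow_zero)
  moreover have "(shift c ^^ (m + n)) w = 0"
    by (simp only: funpow_add o_apply mn shift_funpow_zero)
  ultimately have "(shift c ^^ (m + n)) (v + w) = 0"
    by (simp add: shift_funpow_add add.commute)
  then show "v + w \<in> geigen c"
    using mn subspace_add[OF subspace_A] by (auto simp: geigen_def)
next
  fix a v assume "v \<in> geigen c"
  then obtain n where n: "(shift c ^^ n) v = 0" "v \<in> A"
    by (auto simp: geigen_def)
  then have "(shift c ^^ n) (a *s v) = 0"
    by (simp add: shift_funpow_scale)
  then show "a *s v \<in> geigen c"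
    using n subspace_scale[OF subspace_A] by (auto simp: geigen_def)
qed

lemma geigen_stable:
  assumes "v \<in> geigen c" and "\<And>v. N (shift c v) = shift c (N v)" and "N 0 = 0"
    and "N v \<in> A"
  shows "N v \<in> geigen c"
proof -
  obtain n where "(shift c ^^ n) v = 0"
    using assms(1) by (auto simp: geigen_def)
  then have "(shift c ^^ n) (N v) = 0"
    using shift_funpow_commute[of N c n v] assms(2,3) by simp
  then show ?thesis using assms(4) by (auto simp: geigen_def)
qed

lemma shift_in_geigen: "v \<in> geigen c \<Longrightarrow> shift d v \<in> geigen c"
  using geigen_subset
  by (auto intro!: geigen_stable[where N = "shift d"] shift_stable simp: shift_commute[of d c] shift.zero)

text \<open>Applying the shift once more raises the exponent by one. Inductions below establish
  membership in a generalized eigenspace through this rule.\<close>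

lemma geigen_shiftD:
  assumes "v \<in> A" and "shift c v \<in> geigen c"
  shows "v \<in> geigen c"
proof -
  obtain n where "(shift c ^^ n) (shift c v) = 0"
    using assms(2) by (auto simp: geigen_def)
  then have "(shift c ^^ Suc n) v = 0" by (simp only: shift_funpow_Suc)
  then show ?thesis using assms(1) unfolding geigen_def by blast
qed

text \<open>Induction on the sum of the two exponents: \<open>shift c v\<close> and
  \<open>shift d v\<close> each have a smaller sum, so both vanish, which leaves
  \<open>c *s v = d *s v\<close>.\<close>

lemma geigen_Int:
  assumes "v \<in> geigen c" "v \<in> geigen d" "c \<noteq> d"
  shows "v = 0"
proof -
  have "(shift c ^^ m) v = 0 \<Longrightarrow> (shift d ^^ n) v = 0 \<Longrightarrow> v = 0" for m n v
  proof (induction "m + n" arbitrary: m n v)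
    case 0
    then show ?case by simp
  next
    case (Suc k)
    show ?case
    proof (cases "m = 0 \<or> n = 0")
      case True
      then show ?thesis using Suc.prems by auto
    next
      case False
      then obtain m' n' where mn: "m = Suc m'" "n = Suc n'" by (metis not0_implies_Suc)
      have "shift c v = 0"
      proof (rule Suc.hyps(1)[of m' n])
        show "k = m' + n" using Suc.hyps(2) mn by simp
        show "(shift c ^^ m') (shift c v) = 0" using Suc.prems(1) unfolding mn shift_funpow_Suc .
        show "(shift d ^^ n) (shift c v) = 0"
          using shift_funpow_commute[of "shift c" d n v, OF shift_commute] Suc.prems(2)
          by (simp add: shift.zero)
      qed
      moreover have "shift d v = 0"
      proof (rule Suc.hyps(1)[of m n'])
        show "k = m + n'" using Suc.hyps(2) mn by simp
        show "(shift d ^^ n') (shift d v) = 0" using Suc.prems(2) unfolding mn shift_funpow_Suc .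
        show "(shift c ^^ m) (shift d v) = 0"
          using shift_funpow_commute[of "shift d" c m v, OF shift_commute] Suc.prems(1)
          by (simp add: shift.zero)
      qed
      ultimately have "c *s v = d *s v"
        by (simp add: shift_def)
      then show "v = 0" using assms(3) by simp
    qed
  qed
  then show ?thesis using assms(1,2) by (auto simp: geigen_def)
qed

text \<open>A power of \<open>shift b\<close> that kills \<open>e b\<close> turns the relation into
  one over \<open>L\<close>. By induction it kills every other \<open>e c\<close> as well, so
  \<open>e c\<close> lies in two different generalized eigenspaces and is zero.\<close>

lemma geigen_independent:
  assumes "finite L" "\<And>c. c \<in> L \<Longrightarrow> e c \<in> geigen c" "(\<Sum>c\<in>L. e c) = 0" "d \<in> L"
  shows "e d = 0"
  using assms
proof (induction L arbitrary: e d rule: finite_induct)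
  case empty
  then show ?case by simp
next
  case (insert b L)
  obtain n where n: "(shift b ^^ n) (e b) = 0"
    using insert.prems(1)[of b] by (auto simp: geigen_def)
  have N: "(shift b ^^ n) v \<in> geigen c" if "v \<in> geigen c" for v c
    by (induction n) (use that shift_in_geigen in auto)
  have "(shift b ^^ n) (\<Sum>c\<in>insert b L. e c) = (\<Sum>c\<in>L. (shift b ^^ n) (e c))"
    using insert.hyps n by (simp add: shift_funpow_sum shift_funpow_add)
  then have sum0: "(\<Sum>c\<in>L. (shift b ^^ n) (e c)) = 0"
    by (simp add: insert.prems(2))
  have L: "e c = 0" if "c \<in> L" for c
  proof (rule geigen_Int)
    have "(shift b ^^ n) (e c) = 0"
      using insert.IH[of "\<lambda>c. (shift b ^^ n) (e c)" c] that sum0 N insert.prems(1) by blast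
    moreover have "e c \<in> geigen c" using that insert.prems(1) by blast
    ultimately show "e c \<in> geigen b" "e c \<in> geigen c" using geigen_subset by (auto simp: geigen_def)
    show "b \<noteq> c" using that insert.hyps by blast
  qed
  then have "e b = 0" using insert.prems(2) insert.hyps by simp
  with L insert.prems(3) show ?case by blast
qed

section \<open>The semisimple part as a relation\<close>

text \<open>
  \<open>ss_graph v w\<close> says that the semisimple part of \<open>T\<close> maps \<open>v\<close> to \<open>w\<close>; that this relation is the
  graph of a function is the independence of the generalized eigenspaces.
\<close>

inductive ss_graph :: "'v \<Rightarrow> 'v \<Rightarrow> bool" where
  zero: "ss_graph 0 0"
| step: "ss_graph v w \<Longrightarrow> e \<in> geigen c \<Longrightarrow> ss_graph (v + e) (w + c *s e)"

lemma ss_graph_geigen: "e \<in> geigen c \<Longrightarrow> ss_graph e (c *s e)"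
  using step[OF zero, of e c] by simp

lemma ss_graph_add: "ss_graph v w \<Longrightarrow> ss_graph v' w' \<Longrightarrow> ss_graph (v + v') (w + w')"
proof (induction rule: ss_graph.induct)
  case zero
  then show ?case by simp
next
  case (step v w e c)
  then show ?case using ss_graph.step[of "v + v'" "w + w'" e c] by (simp add: algebra_simps)
qed

text \<open>A linear map that preserves each generalized eigenspace carries a decomposition of
  \<open>v\<close> to one of \<open>N v\<close> with the same scalars.\<close>

lemma ss_graph_image:
  assumes "ss_graph v w" and "module_hom scale scale N"
    and "\<And>c e. e \<in> geigen c \<Longrightarrow> N e \<in> geigen c"
  shows "ss_graph (N v) (N w)"
  using assms(1)
proof (induction rule: ss_graph.induct)
  case zero
  interpret N: module_hom scale scale N by fact
  show ?case by (simp add: ss_graph.zero)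
next
  case (step v w e c)
  interpret N: module_hom scale scale N by fact
  show ?case using ss_graph.step[OF step.IH assms(3)[OF step.hyps(2)]] by (simp add: N.add N.scale)
qed

lemma ss_graph_scale: "ss_graph v w \<Longrightarrow> ss_graph (a *s v) (a *s w)"
  by (erule ss_graph_image)
    (unfold_locales, auto simp: algebra_simps intro: subspace_scale subspace_geigen)

lemma ss_graph_sum: "(\<And>i. i \<in> I \<Longrightarrow> ss_graph (v i) (w i)) \<Longrightarrow> ss_graph (sum v I) (sum w I)"
  by (induction I rule: infinite_finite_induct) (auto intro: zero ss_graph_add)

lemma ss_graph_in_A: "ss_graph v w \<Longrightarrow> v \<in> A \<and> w \<in> A"
proof (induction rule: ss_graph.induct)
  case zero
  then show ?case using subspace_0[OF subspace_A] by simp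
next
  case (step v w e c)
  then show ?case using geigen_subset[of c]
    by (auto intro!: subspace_add[OF subspace_A] subspace_scale[OF subspace_A])
qed

text \<open>A derivation of \<open>ss_graph\<close> may use the same scalar several times; here the
  terms are collected so that each scalar occurs once, as independence requires.\<close>

lemma ss_graph_components:
  assumes "ss_graph v w"
  obtains L e where "finite L" "\<And>c. e c \<in> geigen c" "v = (\<Sum>c\<in>L. e c)" "w = (\<Sum>c\<in>L. c *s e c)"
  using assms
proof (induction arbitrary: thesis rule: ss_graph.induct)
  case zero
  show ?case by (rule zero[of "{}" "\<lambda>_. 0"]) (auto simp: zero_in_geigen)
next
  case (step v w b d)
  obtain L e where L: "finite L" "\<And>c. e c \<in> geigen c" "v = (\<Sum>c\<in>L. e c)" "w = (\<Sum>c\<in>L. c *s e c)"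
    using step.IH by blast
  \<comment> \<open>Outside \<open>L\<close> the values of \<open>e\<close> are arbitrary and must
    be reset to zero, in case \<open>d\<close> is a new scalar.\<close>
  define e' where "e' = (\<lambda>c. (if c \<in> L then e c else 0) + (if c = d then b else 0))"
  show ?case
  proof (rule step.prems[of "insert d L" e'])
    show "finite (insert d L)" using L(1) by simp
    show "e' c \<in> geigen c" for c
      using L(2)[of c] step.hyps(2) subspace_add[OF subspace_geigen, of "e c" c b] zero_in_geigen[of c]
      by (cases "c = d") (simp_all add: e'_def)
    have "(\<Sum>c\<in>insert d L. if c \<in> L then e c else 0) = (\<Sum>c\<in>L. e c)"
      by (rule sum.mono_neutral_cong_right) (use L(1) in auto)
    then show "v + b = (\<Sum>c\<in>insert d L. e' c)"
      using L(1,3) by (simp add: e'_def sum.distrib del: sum.insert)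
    have "(\<Sum>c\<in>insert d L. c *s (if c \<in> L then e c else 0)) = (\<Sum>c\<in>L. c *s e c)"
      by (rule sum.mono_neutral_cong_right) (use L(1) in auto)
    moreover have "(\<Sum>c\<in>insert d L. c *s (if c = d then b else 0)) = d *s b"
      using L(1) by (subst sum.mono_neutral_cong_right[of _ "{d}" _ "\<lambda>_. d *s b"]) auto
    ultimately show "w + d *s b = (\<Sum>c\<in>insert d L. c *s e' c)"
      using L(4) by (simp add: e'_def sum.distrib scale_right_distrib del: sum.insert)
  qed
qed

lemma ss_graph_unique:
  assumes "ss_graph v w" "ss_graph v w'"
  shows "w = w'"
proof -
  \<comment> \<open>The difference of the two pairs is a decomposition of \<open>0\<close>;
    independence kills its components and with them \<open>w - w'\<close>.\<close>
  have "ss_graph (v + (-1) *s v) (w + (-1) *s w')"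
    by (intro ss_graph_add ss_graph_scale assms)
  then obtain L e where L: "finite L" "\<And>c. e c \<in> geigen c" "0 = (\<Sum>c\<in>L. e c)"
      "w - w' = (\<Sum>c\<in>L. c *s e c)"
    by (rule ss_graph_components) auto
  then have "e c = 0" if "c \<in> L" for c
    using that geigen_independent[of L e c] by auto
  then show ?thesis using L(4) by simp
qed

section \<open>Existence of decompositions into generalized eigenvectors\<close>

text \<open>On \<open>geigen d\<close> with \<open>d \<noteq> c\<close> the operator \<open>shift c\<close> is \<open>d - c\<close> plus a nilpotent one, hence onto.\<close>

lemma shift_surj_geigen:
  assumes "c \<noteq> d" "v \<in> geigen d"
  shows "\<exists>w\<in>geigen d. shift c w = v"
proof -
  obtain n where "(shift d ^^ n) v = 0" using assms(2) by (auto simp: geigen_def)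
  then show ?thesis using assms(2)
  proof (induction n arbitrary: v)
    case 0
    then show ?case using zero_in_geigen[of d] by (intro bexI[of _ 0]) (auto simp: shift.zero)
  next
    case (Suc n)
    obtain w where w: "w \<in> geigen d" "shift c w = shift d v"
      using Suc.IH[of "shift d v"] Suc.prems(1)[unfolded shift_funpow_Suc] shift_in_geigen[OF Suc.prems(2)]
      by blast
    \<comment> \<open>The vector \<open>w\<close> given by induction turns
      \<open>shift c (v - w)\<close> into \<open>shift c v - shift d v\<close>, which is a nonzero
      multiple of \<open>v\<close>; dividing by \<open>d - c\<close> gives the preimage.\<close>
    have "shift c (inverse (d - c) *s (v - w)) = inverse (d - c) *s (shift c v - shift d v)"
      using w by (simp add: shift_scale shift.diff)
    also have "shift c v - shift d v = (d - c) *s v"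
      by (simp add: shift_def scale_left_diff_distrib)
    finally have "shift c (inverse (d - c) *s (v - w)) = v"
      using assms(1) by simp
    then show ?case
      using w Suc.prems(2) by (blast intro: subspace_scale subspace_diff subspace_geigen)
  qed
qed

text \<open>Components with scalar different from \<open>c\<close> are images under
  \<open>shift c\<close>; the components with scalar \<open>c\<close> are gathered in the remainder
  \<open>r\<close>.\<close>

lemma ss_graph_shift_lift:
  assumes "ss_graph x y"
  shows "\<exists>v w r. ss_graph v w \<and> r \<in> geigen c \<and> x = shift c v + r"
  using assms
proof (induction rule: ss_graph.induct)
  case zero
  then show ?case using ss_graph.zero zero_in_geigen[of c] shift.zero by fastforce
next
  case (step x y e d)
  then obtain v w r where vwr: "ss_graph v w" "r \<in> geigen c" "x = shift c v + r" by blast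
  show ?case
  proof (cases "d = c")
    case True
    have "x + e = shift c v + (r + e)" using vwr by (simp add: algebra_simps)
    moreover have "r + e \<in> geigen c"
      using vwr step.hyps True by (auto intro: subspace_add[OF subspace_geigen])
    ultimately show ?thesis using vwr(1) by blast
  next
    case False
    then obtain u where u: "u \<in> geigen d" "shift c u = e"
      using shift_surj_geigen[of c d e] step.hyps by auto
    have "x + e = shift c (v + u) + r" using vwr u by (simp add: shift_add algebra_simps)
    then show ?thesis using ss_graph.step[OF vwr(1) u(1)] vwr(2) by blast
  qed
qed

text \<open>Subtracting a lift \<open>v'\<close> of \<open>shift c v\<close> leaves a vector whose
  shift lies in \<open>geigen c\<close>, hence a vector of \<open>geigen c\<close> itself.\<close>

lemma ss_graph_shiftD:
  assumes "v \<in> A" "ss_graph (shift c v) y"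
  shows "\<exists>w. ss_graph v w"
proof -
  obtain v' w' r where r: "ss_graph v' w'" "r \<in> geigen c" "shift c v = shift c v' + r"
    using ss_graph_shift_lift[OF assms(2)] by blast
  have "shift c (v - v') = r" using r by (simp add: shift.diff)
  moreover have "v - v' \<in> A"
    using assms(1) ss_graph_in_A[OF r(1)] by (auto intro: subspace_diff[OF subspace_A])
  ultimately have "v - v' \<in> geigen c" using r(2) geigen_shiftD by blast
  from ss_graph.step[OF r(1) this] show ?thesis by auto
qed

text \<open>This is \<open>p(T) v\<close>. Folding over the coefficients with the vector as a
  further argument gives a Horner recursion in which \<open>T\<close> acts on the vector first, so
  inductions on \<open>p\<close> keep \<open>v\<close> arbitrary.\<close>

definition poly_op :: "'k poly \<Rightarrow> 'v \<Rightarrow> 'v" where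
  "poly_op p v = fold_coeffs (\<lambda>a f v. a *s v + f (T v)) p (\<lambda>_. 0) v"

lemma poly_op_0 [simp]: "poly_op 0 v = 0"
  by (simp add: poly_op_def)

lemma poly_op_pCons [simp]: "poly_op (pCons a p) v = a *s v + poly_op p (T v)"
  by (cases "p = 0 \<and> a = 0") (auto simp: poly_op_def)

lemma poly_op_add: "poly_op (p + q) v = poly_op p v + poly_op q v"
  by (induction p q arbitrary: v rule: poly_induct2) (simp_all add: algebra_simps)

lemma poly_op_smult: "poly_op (smult a p) v = a *s poly_op p v"
  by (induction p arbitrary: v) (simp_all add: algebra_simps)

lemma poly_op_vec_diff: "poly_op p (v - w) = poly_op p v - poly_op p w"
  by (induction p arbitrary: v w) (simp_all add: algebra_simps T.diff)

lemma poly_op_vec_scale: "poly_op p (a *s v) = a *s poly_op p v"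
  by (induction p arbitrary: v) (simp_all add: algebra_simps T_scale)

text \<open>A linear factor moves from the polynomial to the vector, which allows induction on the
  degree.\<close>

lemma poly_op_root: "poly_op ([:-c, 1:] * p) v = poly_op p (shift c v)"
  by (simp add: poly_op_add poly_op_smult shift_def poly_op_vec_diff poly_op_vec_scale flip: smult_minus_left)

lemma poly_op_monom: "poly_op (monom a n) v = a *s (T ^^ n) v"
  by (induction n arbitrary: v) (simp_all add: monom_0 monom_Suc funpow_Suc_right del: funpow.simps(2))

lemma poly_op_sum: "poly_op (sum p I) v = (\<Sum>i\<in>I. poly_op (p i) v)"
  by (induction I rule: infinite_finite_induct) (simp_all add: poly_op_add)

text \<open>Algebraic closedness supplies a root \<open>c\<close> of \<open>p\<close>. The cofactor
  annihilates \<open>shift c v\<close>, which decomposes by induction, and then so does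
  \<open>v\<close>.\<close>

lemma poly_op_ss_graph:
  assumes "p \<noteq> 0" "v \<in> A" "poly_op p v = 0"
  shows "\<exists>w. ss_graph v w"
  using assms
proof (induction "degree p" arbitrary: p v)
  case 0
  then obtain a where "p = [:a:]" "a \<noteq> 0" by (metis degree_eq_zeroE pCons_0_0)
  then have "v = 0" using 0 by simp
  then show ?case using ss_graph.zero by blast
next
  case (Suc n)
  obtain c where "poly p c = 0" using alg_closed_imp_poly_has_root[of p] Suc.hyps by auto
  then obtain q where q: "p = [:-c, 1:] * q" by (meson poly_eq_0_iff_dvd dvdE)
  have "q \<noteq> 0" using Suc.prems q by auto
  then have "degree p = Suc (degree q)" unfolding q by (subst degree_mult_eq) auto
  then have "\<exists>w. ss_graph (shift c v) w"
    using Suc.hyps(1)[of q "shift c v"] Suc.hyps(2) Suc.prems \<open>q \<noteq> 0\<close> q poly_op_root shift_stable by auto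
  then show ?case using ss_graph_shiftD Suc.prems(2) by blast
qed

text \<open>The first \<open>card B + 1\<close> iterates of \<open>v\<close> lie in the span of
  \<open>card B\<close> vectors; a linear relation among them is an annihilating polynomial.\<close>

lemma annihilating_poly:
  assumes "v \<in> A"
  shows "\<exists>p. p \<noteq> 0 \<and> poly_op p v = 0"
proof -
  obtain B where B: "finite B" "\<And>i. (T ^^ i) v \<in> span B" using locally_finite[OF assms] by blast
  define f where "f i = (T ^^ i) v" for i
  show ?thesis
  \<comment> \<open>Linear dependence is a notion for sets and does not see repeated iterates. A
    repetition is treated apart, by the difference of two monomials.\<close>
  proof (cases "inj_on f {..card B}")
    case False
    then obtain i j where ij: "f i = f j" "i \<noteq> j" by (auto simp: inj_on_def)
    have "monom 1 i + monom (-1) j \<noteq> (0 :: 'k poly)"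
    proof
      assume "monom 1 i + monom (-1) j = (0 :: 'k poly)"
      then have "coeff (monom 1 i + monom (-1) j) i = (0 :: 'k)" by simp
      then show False using ij(2) by simp
    qed
    moreover have "poly_op (monom 1 i + monom (-1) j) v = 0"
      using ij(1) by (simp add: poly_op_add poly_op_monom f_def)
    ultimately show ?thesis by blast
  next
    case True
    have "dependent (f ` {..card B})"
      using independent_span_bound[OF B(1), of "f ` {..card B}"] B(2) card_image[OF True]
      by (auto simp: f_def)
    then obtain u w where u: "w \<in> f ` {..card B}" "u w \<noteq> 0" "(\<Sum>w\<in>f ` {..card B}. u w *s w) = 0"
      by (auto simp: dependent_finite)
    define p where "p = (\<Sum>i\<le>card B. monom (u (f i)) i)"
    obtain i where i: "i \<le> card B" "u (f i) \<noteq> 0" using u by auto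
    have "coeff p i = u (f i)"
      using i by (simp add: p_def coeff_sum )
    then have "p \<noteq> 0" using i by auto
    moreover have "poly_op p v = 0"
      using u(3) unfolding sum.reindex[OF True]
      by (simp add: p_def poly_op_sum poly_op_monom f_def o_def)
    ultimately show ?thesis by blast
  qed
qed

lemma ss_graph_total: "v \<in> A \<Longrightarrow> \<exists>w. ss_graph v w"
  using annihilating_poly poly_op_ss_graph by blast

end

subsection \<open>Translations on the coordinate ring\<close>

definition fun_scale :: "'k \<Rightarrow> ('a \<Rightarrow> 'k::field) \<Rightarrow> 'a \<Rightarrow> 'k" where
  "fun_scale c f = (\<lambda>x. c * f x)"

lemma fun_scale_apply [simp]: "fun_scale c f x = c * f x"
  by (simp add: fun_scale_def)

interpretation fun_space: vector_space "fun_scale :: 'k \<Rightarrow> ('a \<Rightarrow> 'k::field) \<Rightarrow> 'a \<Rightarrow> 'k"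
  by unfold_locales (auto simp: fun_eq_iff algebra_simps)

lemma sum_fun_apply: "(\<Sum>i\<in>I. f i) x = (\<Sum>i\<in>I. f i x)"
  for f :: "'i \<Rightarrow> 'a \<Rightarrow> 'k::comm_monoid_add"
  by (induction I rule: infinite_finite_induct) auto

lemma generated_algebra_vanishes:
  assumes "f \<in> generated_algebra X S" "\<And>f x. f \<in> S \<Longrightarrow> x \<notin> X \<Longrightarrow> f x = 0" "x \<notin> X"
  shows "f x = 0"
  using assms(1) by induction (use assms(2,3) in auto)

text \<open>Left translations commute with right translations; they later carry a statement about
  values at the identity to all points of the group.\<close>

definition left_translation :: "('a, 'k::field) alg_group \<Rightarrow> 'a \<Rightarrow> ('a \<Rightarrow> 'k) \<Rightarrow> 'a \<Rightarrow> 'k" where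
  "left_translation G h f = (\<lambda>x. if x \<in> carrier G then f (h \<otimes>\<^bsub>G\<^esub> x) else 0)"

lemma left_translation_hom: "module_hom fun_scale fun_scale (left_translation G h)"
  by unfold_locales (auto simp: left_translation_def fun_eq_iff)

lemma right_translation_hom: "module_hom fun_scale fun_scale (right_translation G h)"
  by unfold_locales (auto simp: right_translation_def fun_eq_iff)

lemmas right_translation_add = module_hom.add[OF right_translation_hom]
  and right_translation_scale = module_hom.scale[OF right_translation_hom]
  and right_translation_diff = module_hom.diff[OF right_translation_hom]
  and right_translation_zero [simp] = module_hom.zero[OF right_translation_hom]
  and right_translation_sum = module_hom.sum[OF right_translation_hom]

context algebraic_group
begin

lemma inv_mult_cancel [simp]:
  assumes "x \<in> carrier G" "y \<in> carrier G"
  shows "inv x \<otimes> (x \<otimes> y) = y" "x \<otimes> (inv x \<otimes> y) = y"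
  using assms by (simp_all flip: m_assoc)

lemma regular_generated:
  "\<exists>S. regular G = generated_algebra (carrier G) S \<and> (\<forall>f\<in>S. \<forall>x. x \<notin> carrier G \<longrightarrow> f x = 0)"
  using variety unfolding affine_variety_def by blast

lemma regular_vanishes:
  assumes "f \<in> regular G" "x \<notin> carrier G"
  shows "f x = 0"
  using regular_generated assms generated_algebra_vanishes[of f "carrier G"] by blast

lemma regular_const: "(\<lambda>x. if x \<in> carrier G then c else 0) \<in> regular G"
  using regular_generated generated_algebra.const[of "carrier G" c] by fastforce

lemma regular_add: "f \<in> regular G \<Longrightarrow> f' \<in> regular G \<Longrightarrow> f + f' \<in> regular G"
  unfolding plus_fun_def using regular_generated generated_algebra.add[of f "carrier G" _ f'] by fastforce

lemma regular_mult: "f \<in> regular G \<Longrightarrow> f' \<in> regular G \<Longrightarrow> f * f' \<in> regular G"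
  unfolding times_fun_def using regular_generated generated_algebra.mult[of f "carrier G" _ f'] by fastforce

lemma regular_scale:
  assumes "f \<in> regular G"
  shows "fun_scale c f \<in> regular G"
proof -
  have "fun_scale c f = (\<lambda>x. if x \<in> carrier G then c else 0) * f"
    using regular_vanishes[OF assms] by (auto simp: fun_eq_iff)
  then show ?thesis using regular_mult[OF regular_const assms] by simp
qed

lemma regular_zero: "0 \<in> regular G"
  using regular_const[of 0] by (simp add: zero_fun_def)

lemma subspace_regular: "fun_space.subspace (regular G)"
  by (rule fun_space.subspaceI) (auto intro: regular_zero regular_add regular_scale)

text \<open>Evaluation at \<open>x\<close> is a character, and a character is represented by exactly
  one point.\<close>

lemma regular_separates:
  assumes "x \<in> carrier G" "y \<in> carrier G" "\<And>f. f \<in> regular G \<Longrightarrow> f x = f y"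
  shows "x = y"
proof -
  have "algebra_character (carrier G) (regular G) (\<lambda>f. f x)"
    using assms(1) by (auto simp: algebra_character_def)
  then have "\<exists>!z. z \<in> carrier G \<and> (\<forall>f\<in>regular G. f x = f z)"
    using variety unfolding affine_variety_def by blast
  then show ?thesis using assms by blast
qed

lemma left_translation_regular:
  assumes "f \<in> regular G" "h \<in> carrier G"
  shows "left_translation G h f \<in> regular G"
proof -
  obtain n :: nat and p q where pq: "\<forall>i<n. p i \<in> regular G \<and> q i \<in> regular G"
      "\<forall>x\<in>carrier G. \<forall>y\<in>carrier G. f (x \<otimes> y) = (\<Sum>i<n. p i x * q i y)"
    using mult_morphism[OF assms(1)] by blast
  have "left_translation G h f = (\<Sum>i<n. fun_scale (p i h) (q i))"
    using pq assms(2) regular_vanishes by (auto simp: fun_eq_iff left_translation_def sum_fun_apply intro!: sum.neutral)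
  also have "\<dots> \<in> regular G"
    using pq by (intro fun_space.subspace_sum[OF subspace_regular] regular_scale) auto
  finally show ?thesis .
qed

text \<open>The left factors \<open>p i\<close> in the expansion of \<open>f (x \<otimes> y)\<close>
  span all right translates of \<open>f\<close>, with coefficients \<open>q i h\<close>. This is the
  source of local finiteness.\<close>

lemma right_translation_span:
  assumes "f \<in> regular G"
  shows "\<exists>B. finite B \<and> B \<subseteq> regular G \<and> (\<forall>h\<in>carrier G. right_translation G h f \<in> fun_space.span B)"
proof -
  obtain n :: nat and p q where pq: "\<forall>i<n. p i \<in> regular G \<and> q i \<in> regular G"
      "\<forall>x\<in>carrier G. \<forall>y\<in>carrier G. f (x \<otimes> y) = (\<Sum>i<n. p i x * q i y)"
    using mult_morphism[OF assms] by blast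
  have "right_translation G h f \<in> fun_space.span (p ` {..<n})" if "h \<in> carrier G" for h
  proof -
    have "right_translation G h f = (\<Sum>i<n. fun_scale (q i h) (p i))"
      using pq that regular_vanishes
      by (auto simp: fun_eq_iff right_translation_def sum_fun_apply mult.commute intro!: sum.neutral)
    also have "\<dots> \<in> fun_space.span (p ` {..<n})"
      by (intro fun_space.span_sum fun_space.span_scale fun_space.span_base) auto
    finally show ?thesis .
  qed
  then show ?thesis using pq(1) by (intro exI[of _ "p ` {..<n}"]) auto
qed

lemma right_translation_regular:
  assumes "f \<in> regular G" "h \<in> carrier G"
  shows "right_translation G h f \<in> regular G"
proof -
  obtain B where "B \<subseteq> regular G" "right_translation G h f \<in> fun_space.span B"
    using right_translation_span[OF assms(1)] assms(2) by blast
  then show ?thesis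
    using fun_space.span_minimal[OF _ subspace_regular] by blast
qed

lemma right_translation_mult:
  assumes "x \<in> carrier G" "y \<in> carrier G"
  shows "right_translation G x (right_translation G y f) = right_translation G (x \<otimes> y) f"
  using assms by (auto simp: right_translation_def fun_eq_iff m_assoc)

lemma right_translation_one: "f \<in> regular G \<Longrightarrow> right_translation G \<one> f = f"
  using regular_vanishes by (auto simp: right_translation_def fun_eq_iff)

lemma right_translation_funpow:
  assumes "h \<in> carrier G" "f \<in> regular G"
  shows "(right_translation G h ^^ n) f = right_translation G (h [^] n) f"
  using assms by (induction n) (auto simp: right_translation_one right_translation_mult nat_pow_Suc2[symmetric] simp del: nat_pow_Suc)

lemma left_right_translation_commute:
  assumes "x \<in> carrier G" "y \<in> carrier G"
  shows "left_translation G x (right_translation G y f) = right_translation G y (left_translation G x f)"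
  using assms by (auto simp: left_translation_def right_translation_def fun_eq_iff m_assoc)

text \<open>The right regular representation is faithful: evaluating translates at the identity
  recovers all values \<open>f x\<close>, and regular functions separate points.\<close>

lemma right_translation_eqD:
  assumes "x \<in> carrier G" "y \<in> carrier G"
    and "\<And>f. f \<in> regular G \<Longrightarrow> right_translation G x f = right_translation G y f"
  shows "x = y"
proof (rule regular_separates)
  fix f assume "f \<in> regular G"
  then have "right_translation G x f \<one> = right_translation G y f \<one>" using assms(3) by simp
  then show "f x = f y" using assms(1,2) by (simp add: right_translation_def)
qed (use assms in auto)

end

section \<open>Right translation by a fixed element and its multiplicative semisimple part\<close>

locale algebraic_group_element = algebraic_group +
  fixes g :: 'a
  assumes g_closed [simp, intro]: "g \<in> carrier G"
begin

sublocale rt: locally_finite_operator fun_scale "right_translation G g" "regular G"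
proof unfold_locales
  fix v :: "'a \<Rightarrow> 'b" assume v: "v \<in> regular G"
  show "right_translation G g v \<in> regular G"
    by (rule right_translation_regular[OF v g_closed])
  obtain B where "finite B" "\<forall>h\<in>carrier G. right_translation G h v \<in> fun_space.span B"
    using right_translation_span[OF v] by blast
  then show "\<exists>B. finite B \<and> (\<forall>i. (right_translation G g ^^ i) v \<in> fun_space.span B)"
    using right_translation_funpow[OF g_closed v] by auto
qed (auto simp: right_translation_add right_translation_scale subspace_regular)

text \<open>A twisted Leibniz rule, valid because right translation is multiplicative. Each summand
  contains one shifted factor.\<close>

lemma shift_mult:
  "rt.shift (c * d) (a * b) = rt.shift c a * right_translation G g b + fun_scale c (a * rt.shift d b)"
  by (auto simp: rt.shift_def fun_eq_iff right_translation_def algebra_simps)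

text \<open>Induction on the sum of the exponents of the factors: both summands of
  \<open>shift_mult\<close> have a smaller sum, so the shift of \<open>a * b\<close> lies in the
  generalized eigenspace, and hence so does \<open>a * b\<close>.\<close>

lemma geigen_mult:
  assumes "a \<in> rt.geigen c" "b \<in> rt.geigen d"
  shows "a * b \<in> rt.geigen (c * d)"
proof -
  have "(rt.shift c ^^ m) a = 0 \<Longrightarrow> (rt.shift d ^^ n) b = 0 \<Longrightarrow> a \<in> regular G \<Longrightarrow> b \<in> regular G
      \<Longrightarrow> a * b \<in> rt.geigen (c * d)" for m n a b
  proof (induction "m + n" arbitrary: m n a b)
    case 0
    then have "a = 0" by (metis add_is_0 funpow_0)
    then show ?case by (simp only: mult_zero_left rt.zero_in_geigen)
  next
    case (Suc k)
    show ?case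
    proof (cases "m = 0 \<or> n = 0")
      case True
      then have "a = 0 \<or> b = 0" using Suc.prems(1,2) by (metis funpow_0)
      then have "a * b = 0" by (metis mult_zero_left mult_zero_right)
      then show ?thesis by (simp only: rt.zero_in_geigen)
    next
      case False
      then obtain m' n' where mn: "m = Suc m'" "n = Suc n'" by (metis not0_implies_Suc)
      have "rt.shift c a * right_translation G g b \<in> rt.geigen (c * d)"
      proof (rule Suc.hyps(1)[of m' n])
        show "k = m' + n" using Suc.hyps(2) mn by simp
        show "(rt.shift c ^^ m') (rt.shift c a) = 0"
          using Suc.prems(1) unfolding mn rt.shift_funpow_Suc .
        \<comment> \<open>Translating the second factor by \<open>g\<close> leaves its exponent
          unchanged.\<close>
        have "right_translation G g (rt.shift d v) = rt.shift d (right_translation G g v)" for v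
          by (simp add: rt.shift_def right_translation_diff right_translation_scale)
        then show "(rt.shift d ^^ n) (right_translation G g b) = 0"
          using rt.shift_funpow_commute[of "right_translation G g" d n b] Suc.prems(2) by simp
      qed (use Suc.prems rt.shift_stable rt.T_stable in auto)
      moreover have "a * rt.shift d b \<in> rt.geigen (c * d)"
      proof (rule Suc.hyps(1)[of m n'])
        show "k = m + n'" using Suc.hyps(2) mn by simp
        show "(rt.shift d ^^ n') (rt.shift d b) = 0"
          using Suc.prems(2) unfolding mn rt.shift_funpow_Suc .
      qed (use Suc.prems rt.shift_stable in auto)
      ultimately have "rt.shift (c * d) (a * b) \<in> rt.geigen (c * d)"
        unfolding shift_mult
        by (intro fun_space.subspace_add fun_space.subspace_scale rt.subspace_geigen)
      then show ?thesis using Suc.prems regular_mult rt.geigen_shiftD by blast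
    qed
  qed
  then show ?thesis using assms unfolding rt.geigen_def by blast
qed

text \<open>By distributivity it suffices to multiply generalized eigenvectors, where the scalars
  \<open>c\<close> and \<open>d\<close> multiply to \<open>c * d\<close> by
  \<open>geigen_mult\<close>.\<close>

lemma ss_graph_mult:
  assumes "rt.ss_graph a a'" "rt.ss_graph b b'"
  shows "rt.ss_graph (a * b) (a' * b')"
  using assms(1)
proof (induction rule: rt.ss_graph.induct)
  case zero
  show ?case unfolding mult_zero_left by (rule rt.ss_graph.zero)
next
  case (step v w e c)
  have "rt.ss_graph (e * b) (fun_scale c e * b')"
    using assms(2)
  proof (induction rule: rt.ss_graph.induct)
    case zero
    show ?case unfolding mult_zero_right by (rule rt.ss_graph.zero)
  next
    case (step x y e' d)
    have eq: "fun_scale c e * (y + fun_scale d e') = fun_scale c e * y + fun_scale (c * d) (e * e')"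
      by (auto simp: fun_eq_iff algebra_simps)
    show ?case
      unfolding distrib_left[of e] eq
      by (rule rt.ss_graph.step[OF step.IH geigen_mult]) (use step \<open>e \<in> rt.geigen c\<close> in auto)
  qed
  then show ?case
    unfolding distrib_right by (rule rt.ss_graph_add[OF step.IH])
qed

text \<open>An operator that commutes with translation by \<open>g\<close> commutes with every
  \<open>shift c\<close> and so preserves the generalized eigenspaces.\<close>

lemma ss_graph_image:
  assumes "rt.ss_graph a b" "module_hom fun_scale fun_scale N"
    and "\<And>f. N (right_translation G g f) = right_translation G g (N f)"
    and "\<And>f. f \<in> regular G \<Longrightarrow> N f \<in> regular G"
  shows "rt.ss_graph (N a) (N b)"
proof (rule rt.ss_graph_image[OF assms(1,2)])
  interpret N: module_hom fun_scale fun_scale N by fact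
  show "N e \<in> rt.geigen c" if "e \<in> rt.geigen c" for c e
    by (rule rt.geigen_stable[where N = N, OF that])
      (use that rt.geigen_subset in \<open>auto simp: rt.shift_def N.diff N.scale assms(3) intro!: assms(4)\<close>)
qed

lemma semisimple_part_exists:
  "\<exists>s\<in>carrier G. \<forall>f\<in>regular G. rt.ss_graph f (right_translation G s f)"
proof -
  define \<sigma> where "\<sigma> f = (THE f'. rt.ss_graph f f')" for f
  have \<sigma>: "rt.ss_graph f (\<sigma> f)" if "f \<in> regular G" for f
    using rt.ss_graph_total[OF that] rt.ss_graph_unique unfolding \<sigma>_def by (metis the_equality)
  have \<sigma>_eq: "\<sigma> f = f'" if "rt.ss_graph f f'" for f f'
    using that rt.ss_graph_unique unfolding \<sigma>_def by blast
  let ?one = "\<lambda>x. if x \<in> carrier G then 1 else 0"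
  have "right_translation G g ?one = ?one"
    by (auto simp: right_translation_def fun_eq_iff)
  then have "?one \<in> rt.geigen 1"
    using regular_const[of 1] by (auto simp: rt.geigen_def rt.shift_def fun_eq_iff intro!: exI[of _ 1])
  then have one: "\<sigma> ?one = ?one"
    using \<sigma>_eq[OF rt.ss_graph_geigen] by (simp add: fun_scale_def)
  \<comment> \<open>The operator \<open>\<sigma>\<close> is linear, multiplicative and fixes the
    unit, so its value at the identity is evaluation at a point \<open>s\<close>.\<close>
  have "algebra_character (carrier G) (regular G) (\<lambda>f. \<sigma> f \<one>)"
    unfolding algebra_character_def
  proof (intro conjI ballI allI)
    show "\<sigma> ?one \<one> = 1" by (simp only: one one_closed if_True)
  next
    fix f f' assume f: "f \<in> regular G" "f' \<in> regular G"
    show "\<sigma> (\<lambda>x. f x + f' x) \<one> = \<sigma> f \<one> + \<sigma> f' \<one>"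
      using \<sigma>_eq[OF rt.ss_graph_add[OF \<sigma> \<sigma>], OF f] by (simp only: plus_fun_def)
    show "\<sigma> (\<lambda>x. f x * f' x) \<one> = \<sigma> f \<one> * \<sigma> f' \<one>"
      using \<sigma>_eq[OF ss_graph_mult[OF \<sigma> \<sigma>], OF f] by (simp only: times_fun_def)
  next
    fix c f assume f: "f \<in> regular G"
    show "\<sigma> (\<lambda>x. c * f x) \<one> = c * \<sigma> f \<one>"
      using \<sigma>_eq[OF rt.ss_graph_scale[OF \<sigma>[OF f], of c]] by (simp only: fun_scale_def)
  qed
  then obtain s where s: "s \<in> carrier G" "\<And>f. f \<in> regular G \<Longrightarrow> \<sigma> f \<one> = f s"
    using variety unfolding affine_variety_def by metis
  have "right_translation G s f = \<sigma> f" if f: "f \<in> regular G" for f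
  proof
    fix x
    show "right_translation G s f x = \<sigma> f x"
    proof (cases "x \<in> carrier G")
      case True
      \<comment> \<open>Since \<open>\<sigma>\<close> commutes with left translation by
        \<open>x\<close>, its value at \<open>x\<close> is its value at the identity on the
        translated function, namely \<open>f (x \<otimes> s)\<close>.\<close>
      have "rt.ss_graph (left_translation G x f) (left_translation G x (\<sigma> f))"
        by (rule ss_graph_image[OF \<sigma>[OF f] left_translation_hom])
          (auto simp: True left_right_translation_commute left_translation_regular)
      then have "\<sigma> (left_translation G x f) = left_translation G x (\<sigma> f)"
        by (rule \<sigma>_eq)
      moreover have "\<sigma> (left_translation G x f) \<one> = left_translation G x f s"
        using s True f left_translation_regular by blast
      ultimately show ?thesis
        using s(1) True by (simp add: left_translation_def right_translation_def)
    next
      case False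
      then show ?thesis
        using rt.ss_graph_in_A[OF \<sigma>[OF f]] regular_vanishes by (auto simp: right_translation_def)
    qed
  qed
  then show ?thesis using s \<sigma> by metis
qed

subsection \<open>Jordan decomposition\<close>

text \<open>This is the uniqueness half. If translation by \<open>s\<close> multiplies
  \<open>e\<close> by \<open>c\<close>, then \<open>shift c\<close> acts on \<open>e\<close> as
  \<open>c\<close> times the locally nilpotent operator of \<open>u\<close> minus the identity, so
  \<open>e\<close> lies in \<open>geigen c\<close>; such eigenvectors span.\<close>

lemma jordan_ss_graph:
  assumes "jordan_decomposition G g (s, u)" "f \<in> regular G"
  shows "rt.ss_graph f (right_translation G s f)"
proof -
  have su: "semisimple G s" "unipotent G u" "g = s \<otimes> u" "g = u \<otimes> s"
    using assms(1) by (auto simp: jordan_decomposition_def)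
  have [simp]: "s \<in> carrier G" "u \<in> carrier G"
    using su by (auto simp: semisimple_def unipotent_def)
  define N where "N = (\<lambda>h :: 'a \<Rightarrow> 'b. right_translation G u h - h)"
  have N: "N = (\<lambda>h x. right_translation G u h x - h x)"
    by (simp add: N_def fun_eq_iff)
  have eigen: "e \<in> rt.geigen c"
    if "(N ^^ n) e = 0" "e \<in> regular G" "right_translation G s e = fun_scale c e" for n e c
    using that
  proof (induction n arbitrary: e)
    case 0
    then have "e = 0" by (metis funpow_0)
    then show ?case by (simp only: rt.zero_in_geigen)
  next
    case (Suc n)
    have "N e \<in> rt.geigen c"
    proof (rule Suc.IH)
      show "(N ^^ n) (N e) = 0"
        using Suc.prems(1) by (simp only: funpow_Suc_right o_apply)
      show "N e \<in> regular G"
        unfolding N_def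
        by (intro fun_space.subspace_diff[OF subspace_regular] right_translation_regular Suc.prems) simp
      \<comment> \<open>Commutation of \<open>s\<close> and \<open>u\<close> keeps
        \<open>N e\<close> an eigenvector of \<open>s\<close> with the same scalar, as the induction
        demands.\<close>
      have "right_translation G s (right_translation G u e) = right_translation G u (right_translation G s e)"
        using su by (simp add: right_translation_mult)
      also have "\<dots> = fun_scale c (right_translation G u e)"
        by (simp only: Suc.prems(3) right_translation_scale)
      finally show "right_translation G s (N e) = fun_scale c (N e)"
        by (simp only: N_def right_translation_diff Suc.prems(3) fun_space.scale_right_diff_distrib)
    qed
    moreover have "rt.shift c e = fun_scale c (N e)"
    proof -
      have "right_translation G g e = right_translation G u (right_translation G s e)"
        using su by (simp add: right_translation_mult)
      also have "\<dots> = fun_scale c (right_translation G u e)"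
        by (simp only: Suc.prems(3) right_translation_scale)
      finally show ?thesis
        by (simp only: rt.shift_def N_def fun_space.scale_right_diff_distrib)
    qed
    ultimately have "rt.shift c e \<in> rt.geigen c"
      by (simp only: fun_space.subspace_scale[OF rt.subspace_geigen])
    then show ?case using Suc.prems(2) rt.geigen_shiftD by blast
  qed
  obtain E where E: "finite E" "f = (\<lambda>x. \<Sum>e\<in>E. e x)"
      "\<And>e. e \<in> E \<Longrightarrow> e \<in> regular G \<and> (\<exists>c. right_translation G s e = (\<lambda>x. c * e x))"
    using su(1) assms(2) unfolding semisimple_def by metis
  have "rt.ss_graph e (right_translation G s e)" if e: "e \<in> E" for e
  proof -
    obtain c where c: "right_translation G s e = fun_scale c e"
      using E(3)[OF e] by (auto simp: fun_scale_def)
    obtain n where n: "(N ^^ n) e = 0"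
      using su(2) E(3)[OF e] unfolding unipotent_def N zero_fun_def by blast
    then show ?thesis
      unfolding c using rt.ss_graph_geigen[OF eigen[OF n _ c]] E(3)[OF e] by blast
  qed
  then have "rt.ss_graph (\<Sum>e\<in>E. e) (\<Sum>e\<in>E. right_translation G s e)"
    by (rule rt.ss_graph_sum)
  moreover have "(\<Sum>e\<in>E. e) = f"
    by (simp add: E(2) fun_eq_iff sum_fun_apply)
  ultimately show ?thesis
    by (simp only: right_translation_sum[symmetric])
qed

text \<open>Translation by \<open>h\<close> commutes with translation by \<open>g\<close>, hence
  with its semisimple part; uniqueness of that part and faithfulness give the equation in the
  group.\<close>

lemma ss_graph_centralizer:
  assumes "s \<in> carrier G" "\<And>f. f \<in> regular G \<Longrightarrow> rt.ss_graph f (right_translation G s f)"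
    and "h \<in> centralizer G g"
  shows "h \<otimes> s = s \<otimes> h"
proof (rule right_translation_eqD)
  have h: "h \<in> carrier G" "h \<otimes> g = g \<otimes> h"
    using assms(3) by (auto simp: centralizer_def)
  show "h \<otimes> s \<in> carrier G" "s \<otimes> h \<in> carrier G" using h assms(1) by auto
  fix f assume f: "f \<in> regular G"
  have "rt.ss_graph (right_translation G h f) (right_translation G h (right_translation G s f))"
    by (rule ss_graph_image[OF assms(2)[OF f] right_translation_hom])
      (auto simp: h right_translation_mult right_translation_regular)
  moreover have "rt.ss_graph (right_translation G h f) (right_translation G s (right_translation G h f))"
    by (intro assms(2) right_translation_regular f h)
  ultimately have "right_translation G h (right_translation G s f)
      = right_translation G s (right_translation G h f)"
    by (rule rt.ss_graph_unique)
  then show "right_translation G (h \<otimes> s) f = right_translation G (s \<otimes> h) f"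
    using h assms(1) by (simp add: right_translation_mult)
qed

lemma ss_graph_eigen:
  assumes "\<And>f. f \<in> regular G \<Longrightarrow> rt.ss_graph f (right_translation G s f)" "e \<in> rt.geigen c"
  shows "right_translation G s e = fun_scale c e"
  using rt.ss_graph_unique[OF assms(1) rt.ss_graph_geigen[OF assms(2)]] assms(2) rt.geigen_subset
  by blast

lemma ss_graph_semisimple:
  assumes "s \<in> carrier G" "\<And>f. f \<in> regular G \<Longrightarrow> rt.ss_graph f (right_translation G s f)"
  shows "semisimple G s"
  unfolding semisimple_def
proof (intro conjI ballI assms(1))
  fix f assume "f \<in> regular G"
  then obtain L e where L: "finite L" "\<And>c. e c \<in> rt.geigen c" "f = (\<Sum>c\<in>L. e c)"
    using rt.ss_graph_components[OF assms(2)] by blast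
  \<comment> \<open>The definition of \<open>semisimple\<close> sums over a set of eigenvectors.
    Dropping zero components makes \<open>e\<close> injective, so no summand is lost in the
    image.\<close>
  define K where "K = {c \<in> L. e c \<noteq> 0}"
  have "inj_on e K"
  proof (rule inj_onI)
    fix c d assume cd: "c \<in> K" "d \<in> K" "e c = e d"
    have "e c \<in> rt.geigen d" using L(2)[of d] cd(3) by simp
    then show "c = d" using rt.geigen_Int[OF L(2)[of c]] cd(1) unfolding K_def by blast
  qed
  then have "(\<Sum>v\<in>e ` K. v) = (\<Sum>c\<in>K. e c)" by (simp add: sum.reindex)
  also have "\<dots> = f" unfolding L(3) K_def by (rule sum.mono_neutral_left) (use L(1) in auto)
  finally have "f = (\<lambda>x. \<Sum>v\<in>e ` K. v x)" by (auto simp: fun_eq_iff sum_fun_apply)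
  moreover have "v \<in> regular G \<and> (\<exists>c. right_translation G s v = (\<lambda>x. c * v x))" if "v \<in> e ` K" for v
    using that ss_graph_eigen[OF assms(2) L(2)] L(2) rt.geigen_subset unfolding fun_scale_def by blast
  ultimately show "\<exists>E. finite E \<and> (\<forall>e\<in>E. e \<in> regular G \<and>
      (\<exists>c. right_translation G s e = (\<lambda>x. c * e x))) \<and> f = (\<lambda>x. \<Sum>e\<in>E. e x)"
    using L(1) unfolding K_def by (intro exI[of _ "e ` {c \<in> L. e c \<noteq> 0}"]) simp
qed

text \<open>On \<open>geigen c\<close> with \<open>c\<close> nonzero, translation by
  \<open>u\<close> minus the identity is \<open>inverse c\<close> times \<open>shift c\<close>,
  hence locally nilpotent.\<close>

lemma ss_graph_unipotent:
  assumes "s \<in> carrier G" "\<And>f. f \<in> regular G \<Longrightarrow> rt.ss_graph f (right_translation G s f)"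
    and "u \<in> carrier G" "g = s \<otimes> u" "g = u \<otimes> s"
  shows "unipotent G u"
proof -
  define N where "N = (\<lambda>h :: 'a \<Rightarrow> 'b. right_translation G u h - h)"
  have N: "N = (\<lambda>h x. right_translation G u h x - h x)"
    by (simp add: N_def fun_eq_iff)
  have "N (a + b) = N a + N b" for a b
    by (simp only: N_def right_translation_add add_diff_add)
  then have N_add: "(N ^^ n) (a + b) = (N ^^ n) a + (N ^^ n) b" for n a b
    by (induction n) (simp_all only: funpow_0 funpow.simps(2) o_apply)
  have N_0: "(N ^^ n) 0 = 0" for n
    by (induction n) (simp_all only: funpow_0 funpow.simps(2) o_apply N_def right_translation_zero diff_self)
  have kill: "(N ^^ n) e = 0" if "(rt.shift c ^^ n) e = 0" "e \<in> rt.geigen c" "c \<noteq> 0" for n c e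
    using that(1,2)
  proof (induction n arbitrary: e)
    case 0
    then show ?case by (metis funpow_0)
  next
    case (Suc n)
    have "right_translation G g e = right_translation G u (right_translation G s e)"
      using assms by (simp add: right_translation_mult)
    also have "\<dots> = fun_scale c (right_translation G u e)"
      by (simp only: ss_graph_eigen[OF assms(2) Suc.prems(2)] right_translation_scale)
    finally have "rt.shift c e = fun_scale c (N e)"
      by (simp only: rt.shift_def N_def fun_space.scale_right_diff_distrib)
    then have Ne: "N e = fun_scale (inverse c) (rt.shift c e)"
      using that(3) by (simp add: fun_eq_iff)
    have "(N ^^ n) (N e) = 0"
    proof (rule Suc.IH)
      show "(rt.shift c ^^ n) (N e) = 0"
        using Suc.prems(1)
        by (simp only: Ne rt.shift_funpow_scale rt.shift_funpow_Suc fun_space.scale_zero_right)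
      show "N e \<in> rt.geigen c"
        unfolding Ne by (intro fun_space.subspace_scale rt.subspace_geigen rt.shift_in_geigen Suc.prems)
    qed
    then show ?case by (simp only: funpow_Suc_right o_apply)
  qed
  have geigen: "\<exists>n. (N ^^ n) e = 0" if e: "e \<in> rt.geigen c" for e c
  proof (cases "c = 0")
    \<comment> \<open>The generalized eigenspace for \<open>0\<close> is trivial: \<open>s\<close>
      acts on it by zero but also invertibly.\<close>
    case True
    have "e = right_translation G (inv s) (right_translation G s e)"
      using subsetD[OF rt.geigen_subset e] assms(1)
      by (simp add: right_translation_mult right_translation_one)
    also have "\<dots> = 0"
      by (simp only: ss_graph_eigen[OF assms(2) e] True fun_space.scale_zero_left right_translation_zero)
    finally show ?thesis by (metis N_0)
  next
    case False
    then show ?thesis using kill e unfolding rt.geigen_def by blast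
  qed
  have "\<exists>n. (N ^^ n) f = 0" if "rt.ss_graph f f'" for f f'
    using that
  proof (induction rule: rt.ss_graph.induct)
    case zero
    show ?case using N_0 by blast
  next
    case (step v w e c)
    then obtain m n where mn: "(N ^^ m) v = 0" "(N ^^ n) e = 0" using geigen by blast
    have "(N ^^ (n + m)) v = 0"
      by (simp only: funpow_add o_apply mn N_0)
    moreover have "(N ^^ (m + n)) e = 0"
      by (simp only: funpow_add o_apply mn N_0)
    ultimately have "(N ^^ (m + n)) (v + e) = 0"
      by (simp only: N_add add.commute[of n m] add_0_left)
    then show ?case by blast
  qed
  then show ?thesis
    using assms(2,3) unfolding unipotent_def N zero_fun_def by blast
qed

lemma jordan_decomposition_ex1: "\<exists>!p. jordan_decomposition G g p"
proof -
  obtain s where s: "s \<in> carrier G" "\<And>f. f \<in> regular G \<Longrightarrow> rt.ss_graph f (right_translation G s f)"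
    using semisimple_part_exists by blast
  \<comment> \<open>The element \<open>g\<close> lies in its own centralizer, so it commutes with
    \<open>s\<close>; this makes \<open>inv s \<otimes> g\<close> a factor on either side.\<close>
  have comm: "g \<otimes> s = s \<otimes> g"
    by (rule ss_graph_centralizer[OF s]) (auto simp: centralizer_def)
  define u where "u = inv s \<otimes> g"
  have u: "u \<in> carrier G" "g = s \<otimes> u" "g = u \<otimes> s"
    using s(1) comm by (simp_all add: u_def m_assoc)
  have ex: "jordan_decomposition G g (s, u)"
    using ss_graph_semisimple[OF s] ss_graph_unipotent[OF s u] u by (simp add: jordan_decomposition_def)
  have "p = (s, u)" if p: "jordan_decomposition G g p" for p
  proof -
    obtain s' u' where su': "p = (s', u')" by (cases p)
    have c: "s' \<in> carrier G" "u' \<in> carrier G" "g = s' \<otimes> u'"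
      using p by (auto simp: su' jordan_decomposition_def semisimple_def unipotent_def)
    have "s' = s"
    proof (rule right_translation_eqD[OF c(1) s(1)])
      fix f assume f: "f \<in> regular G"
      show "right_translation G s' f = right_translation G s f"
        using rt.ss_graph_unique jordan_ss_graph[OF p[unfolded su'] f] s(2)[OF f] by blast
    qed
    moreover have "u' = u"
      using c u s(1) \<open>s' = s\<close> by (metis Units_eq Units_l_cancel)
    ultimately show ?thesis using su' by simp
  qed
  with ex show ?thesis by blast
qed

text \<open>Unique existence makes the \<open>THE\<close> in \<open>semisimple_part\<close> denote a
  true Jordan decomposition, to which \<open>ss_graph_centralizer\<close> applies.\<close>

lemma centralizer_subset_semisimple_part:
  "centralizer G g \<subseteq> centralizer G (semisimple_part G g)"
proof
  fix h assume h: "h \<in> centralizer G g"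
  define p where "p = (THE p. jordan_decomposition G g p)"
  have "jordan_decomposition G g p"
    unfolding p_def by (rule theI'[OF jordan_decomposition_ex1])
  moreover have "p = (semisimple_part G g, unipotent_part G g)"
    by (simp add: p_def semisimple_part_def unipotent_part_def)
  ultimately have jd: "jordan_decomposition G g (semisimple_part G g, unipotent_part G g)"
    by simp
  then have "semisimple_part G g \<in> carrier G"
    by (simp add: jordan_decomposition_def semisimple_def)
  then have "h \<otimes> semisimple_part G g = semisimple_part G g \<otimes> h"
    by (rule ss_graph_centralizer[OF _ jordan_ss_graph[OF jd] h])
  then show "h \<in> centralizer G (semisimple_part G g)"
    using h by (simp add: centralizer_def)
qed

end

subsection \<open>Identity components\<close>

context algebraic_group
begin

lemma topspace_zariski: "topspace (zariski G) = carrier G"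
proof
  show "topspace (zariski G) \<subseteq> carrier G"
    unfolding topspace_def using openin_zariski[OF algebraic_group_axioms]
    by (auto simp: zariski_open_def)
  have "zariski_open G (carrier G)"
    unfolding zariski_open_def
    by (rule exI[of _ "{\<lambda>x. if x \<in> carrier G then 1 else 0}"]) (auto simp: regular_const)
  then show "carrier G \<subseteq> topspace (zariski G)"
    using openin_zariski[OF algebraic_group_axioms] openin_subset by blast
qed

text \<open>The preimage of the nonvanishing set of a family of functions is the nonvanishing set of
  the pulled back family.\<close>

lemma continuous_map_zariskiI:
  assumes "\<And>x. x \<in> carrier G \<Longrightarrow> \<phi> x \<in> carrier G"
    and "\<And>f. f \<in> regular G \<Longrightarrow> (\<lambda>x. if x \<in> carrier G then f (\<phi> x) else 0) \<in> regular G"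
  shows "continuous_map (zariski G) (zariski G) \<phi>"
  unfolding continuous_map_def topspace_zariski
proof (intro conjI allI impI)
  show "\<phi> \<in> carrier G \<rightarrow> carrier G" using assms(1) by blast
  fix U assume "openin (zariski G) U"
  then obtain F where F: "F \<subseteq> regular G" "U = {x \<in> carrier G. \<exists>f\<in>F. f x \<noteq> 0}"
    using openin_zariski[OF algebraic_group_axioms] unfolding zariski_open_def by blast
  have "zariski_open G {x \<in> carrier G. \<phi> x \<in> U}"
    unfolding zariski_open_def
    by (rule exI[of _ "(\<lambda>f x. if x \<in> carrier G then f (\<phi> x) else 0) ` F"])
      (use F assms in auto)
  then show "openin (zariski G) {x \<in> carrier G. \<phi> x \<in> U}"
    by (simp add: openin_zariski[OF algebraic_group_axioms])
qed

lemma continuous_map_mult_left: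
  assumes "h \<in> carrier G"
  shows "continuous_map (zariski G) (zariski G) (\<lambda>x. h \<otimes> x)"
  by (rule continuous_map_zariskiI)
    (use assms left_translation_regular in \<open>auto simp: left_translation_def\<close>)

lemma continuous_map_mult_right:
  assumes "h \<in> carrier G"
  shows "continuous_map (zariski G) (zariski G) (\<lambda>x. x \<otimes> h)"
  by (rule continuous_map_zariskiI)
    (use assms right_translation_regular in \<open>auto simp: right_translation_def\<close>)

lemma continuous_map_conj:
  assumes "h \<in> carrier G"
  shows "continuous_map (zariski G) (zariski G) (\<lambda>x. h \<otimes> x \<otimes> inv h)"
  using continuous_map_compose[OF continuous_map_mult_left[OF assms]
      continuous_map_mult_right[OF inv_closed[OF assms]]]
  by (simp add: o_def)

lemma identity_component_subset: "identity_component G H \<subseteq> H" "identity_component G H \<subseteq> carrier G"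
  using connected_component_of_subset_topspace[of "subtopology (zariski G) H"]
  by (auto simp: identity_component_def topspace_zariski)

lemma connectedin_identity_component: "connectedin (zariski G) (identity_component G H)"
  using connectedin_connected_component_of[of "subtopology (zariski G) H"]
  by (simp add: identity_component_def connectedin_subtopology)

lemma identity_component_maximal:
  "connectedin (zariski G) S \<Longrightarrow> S \<subseteq> H \<Longrightarrow> \<one> \<in> S \<Longrightarrow> S \<subseteq> identity_component G H"
  unfolding identity_component_def
  by (intro connected_component_of_maximal) (auto simp: connectedin_subtopology)

lemma one_in_identity_component: "\<one> \<in> H \<Longrightarrow> \<one> \<in> identity_component G H"
  by (simp add: identity_component_def connected_component_of_refl topspace_zariski)

text \<open>The inclusion is asked of the component alone, since a connected set through the
  identity has only to lie in \<open>K\<close>. In the application the full centralizers need not be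
  nested.\<close>

lemma identity_component_mono:
  assumes "\<one> \<in> H" "identity_component G H \<subseteq> K"
  shows "identity_component G H \<subseteq> identity_component G K"
  using assms
  by (intro identity_component_maximal connectedin_identity_component one_in_identity_component)

text \<open>Left translation by \<open>inv x\<close> carries the identity component to a connected
  set that contains the identity because \<open>x\<close> was in the component.\<close>

lemma identity_component_inv_mult:
  assumes "x \<in> identity_component G (carrier G)" "y \<in> identity_component G (carrier G)"
  shows "inv x \<otimes> y \<in> identity_component G (carrier G)"
proof -
  have x: "x \<in> carrier G" using assms(1) identity_component_subset by blast
  have "connectedin (zariski G) ((\<lambda>z. inv x \<otimes> z) ` identity_component G (carrier G))"
    by (rule connectedin_continuous_map_image[OF continuous_map_mult_left connectedin_identity_component])
      (use x in auto)
  moreover have "\<one> \<in> (\<lambda>z. inv x \<otimes> z) ` identity_component G (carrier G)"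
    by (rule image_eqI[OF _ assms(1)]) (simp add: x)
  moreover have "(\<lambda>z. inv x \<otimes> z) ` identity_component G (carrier G) \<subseteq> carrier G"
    using x identity_component_subset(2)[of "carrier G"] by auto
  ultimately show ?thesis using identity_component_maximal assms(2) by blast
qed

lemma identity_component_inv:
  "x \<in> identity_component G (carrier G) \<Longrightarrow> inv x \<in> identity_component G (carrier G)"
  using identity_component_inv_mult[of x \<one>] one_in_identity_component[of "carrier G"]
    subsetD[OF identity_component_subset(2), of x "carrier G"] by simp

lemma identity_component_mult:
  assumes "x \<in> identity_component G (carrier G)" "y \<in> identity_component G (carrier G)"
  shows "x \<otimes> y \<in> identity_component G (carrier G)"
  using identity_component_inv_mult[OF identity_component_inv[OF assms(1)] assms(2)]
    subsetD[OF identity_component_subset(2) assms(1)] by simp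

lemma one_in_centralizer: "g \<in> carrier G \<Longrightarrow> \<one> \<in> centralizer G g"
  by (simp add: centralizer_def)

section \<open>Conjugation of centralizers and their identity components\<close>

lemma conj_cancel:
  assumes "x \<in> carrier G" "y \<in> carrier G"
  shows "x \<otimes> (inv x \<otimes> y \<otimes> x) \<otimes> inv x = y" "inv x \<otimes> (x \<otimes> y \<otimes> inv x) \<otimes> x = y"
  using assms by (simp_all add: m_assoc)

lemma conj_mult:
  assumes "x \<in> carrier G" "y \<in> carrier G" "z \<in> carrier G"
  shows "(x \<otimes> y \<otimes> inv x) \<otimes> (x \<otimes> z \<otimes> inv x) = x \<otimes> (y \<otimes> z) \<otimes> inv x"
  using assms by (simp add: m_assoc)

lemma identity_component_centralizer_conj_subset:
  assumes "x \<in> carrier G" "g \<in> carrier G"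
  shows "(\<lambda>a. x \<otimes> a \<otimes> inv x) ` identity_component G (centralizer G g)
      \<subseteq> identity_component G (centralizer G (x \<otimes> g \<otimes> inv x))"
proof (rule identity_component_maximal)
  show "connectedin (zariski G) ((\<lambda>a. x \<otimes> a \<otimes> inv x) ` identity_component G (centralizer G g))"
    by (rule connectedin_continuous_map_image[OF continuous_map_conj connectedin_identity_component])
      (use assms in auto)
  have "x \<otimes> a \<otimes> inv x \<in> centralizer G (x \<otimes> g \<otimes> inv x)" if "a \<in> centralizer G g" for a
    using that assms conj_mult by (auto simp: centralizer_def)
  then show "(\<lambda>a. x \<otimes> a \<otimes> inv x) ` identity_component G (centralizer G g)
      \<subseteq> centralizer G (x \<otimes> g \<otimes> inv x)"
    using identity_component_subset(1) by blast
  show "\<one> \<in> (\<lambda>a. x \<otimes> a \<otimes> inv x) ` identity_component G (centralizer G g)"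
    by (rule image_eqI[OF _ one_in_identity_component[OF one_in_centralizer]]) (simp_all add: assms)
qed

lemma identity_component_centralizer_conj:
  assumes "x \<in> carrier G" "g \<in> carrier G"
  shows "identity_component G (centralizer G (x \<otimes> g \<otimes> inv x))
      = (\<lambda>a. x \<otimes> a \<otimes> inv x) ` identity_component G (centralizer G g)"
proof
  show "identity_component G (centralizer G (x \<otimes> g \<otimes> inv x))
      \<subseteq> (\<lambda>a. x \<otimes> a \<otimes> inv x) ` identity_component G (centralizer G g)"
  proof
    fix b assume b: "b \<in> identity_component G (centralizer G (x \<otimes> g \<otimes> inv x))"
    then have "b \<in> carrier G" using identity_component_subset by blast
    \<comment> \<open>The reverse inclusion is the first one for \<open>inv x\<close> and the
      conjugated element.\<close>
    moreover have "inv x \<otimes> b \<otimes> x \<in> identity_component G (centralizer G g)"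
      using identity_component_centralizer_conj_subset[of "inv x" "x \<otimes> g \<otimes> inv x"] b assms
      by (auto simp: conj_cancel)
    ultimately show "b \<in> (\<lambda>a. x \<otimes> a \<otimes> inv x) ` identity_component G (centralizer G g)"
      using assms conj_cancel(1)[of x b] by (intro image_eqI[of b _ "inv x \<otimes> b \<otimes> x"]) simp_all
  qed
qed (rule identity_component_centralizer_conj_subset[OF assms])

subsection \<open>Strata\<close>

text \<open>The inclusion of centralizers passes to identity components, and the torus is central in
  the larger one.\<close>

lemma stratum_torus_commute:
  assumes g: "g \<in> carrier G" and t: "t \<in> stratum_torus G g"
    and h: "h \<in> identity_component G (centralizer G g)"
  shows "t \<otimes> h = h \<otimes> t"
proof -
  interpret algebraic_group_element G g by unfold_locales (rule g)
  have "identity_component G (centralizer G g)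
      \<subseteq> identity_component G (centralizer G (semisimple_part G g))"
    using identity_component_mono[OF one_in_centralizer[OF g]] identity_component_subset(1)
      centralizer_subset_semisimple_part by blast
  moreover have "t \<in> centre G (identity_component G (centralizer G (semisimple_part G g)))"
    using t identity_component_subset(1) unfolding stratum_torus_def by blast
  ultimately show ?thesis
    using h unfolding centre_def by blast
qed

lemma torus_equiv_identity_component_centralizer:
  assumes g: "g \<in> carrier G" and g': "g' \<in> carrier G" and eq: "torus_equiv G g g'"
  shows "identity_component G (centralizer G g) = identity_component G (centralizer G g')"
proof -
  define t where "t = g' \<otimes> inv g"
  \<comment> \<open>The two tori coincide, so \<open>t\<close> commutes with both identity
    components and either inclusion can be proved.\<close>
  have t: "t \<in> carrier G" "g' = t \<otimes> g" "t \<in> stratum_torus G g" "t \<in> stratum_torus G g'"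
    using assms by (auto simp: t_def torus_equiv_def m_assoc)
  show ?thesis
  proof
    have "h \<in> centralizer G g'" if h: "h \<in> identity_component G (centralizer G g)" for h
    proof -
      have hG: "h \<in> carrier G" "h \<otimes> g = g \<otimes> h"
        using h identity_component_subset(1) unfolding centralizer_def by blast+
      have "h \<otimes> (t \<otimes> g) = (t \<otimes> h) \<otimes> g"
        using hG t(1) g stratum_torus_commute[OF g t(3) h] by (simp flip: m_assoc)
      also have "\<dots> = t \<otimes> g \<otimes> h"
        using hG t(1) g by (simp add: m_assoc)
      finally show ?thesis using hG(1) by (simp add: centralizer_def t(2))
    qed
    then show "identity_component G (centralizer G g) \<subseteq> identity_component G (centralizer G g')"
      by (intro identity_component_mono one_in_centralizer g subsetI)
    have "h \<in> centralizer G g" if h: "h \<in> identity_component G (centralizer G g')" for h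
    proof -
      have hG: "h \<in> carrier G" "h \<otimes> g' = g' \<otimes> h"
        using h identity_component_subset(1) unfolding centralizer_def by blast+
      \<comment> \<open>Here \<open>h\<close> commutes with \<open>t \<otimes> g\<close> and with
        \<open>t\<close>; cancelling \<open>t\<close> on the left shows that it commutes with
        \<open>g\<close>.\<close>
      have "t \<otimes> (h \<otimes> g) = (h \<otimes> t) \<otimes> g"
        using hG t(1) g stratum_torus_commute[OF g' t(4) h] by (simp flip: m_assoc)
      also have "\<dots> = t \<otimes> (g \<otimes> h)"
        using hG t(1,2) g by (simp add: m_assoc)
      finally have "h \<otimes> g = g \<otimes> h" using hG(1) t(1) g by simp
      then show ?thesis using hG(1) by (simp add: centralizer_def)
    qed
    then show "identity_component G (centralizer G g') \<subseteq> identity_component G (centralizer G g)"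
      by (intro identity_component_mono one_in_centralizer g' subsetI)
  qed
qed

lemma stratum_rel_conjugate:
  assumes "(g, g') \<in> stratum_rel G"
  obtains x where "x \<in> identity_component G (carrier G)"
    "identity_component G (centralizer G g')
      = (\<lambda>a. x \<otimes> a \<otimes> inv x) ` identity_component G (centralizer G g)"
proof -
  obtain x where x: "g \<in> carrier G" "g' \<in> carrier G" "x \<in> identity_component G (carrier G)"
      "torus_equiv G (x \<otimes> g \<otimes> inv x) g'"
    using assms unfolding stratum_rel_def by blast
  have xG: "x \<in> carrier G" using x(3) identity_component_subset(2) by blast
  have "identity_component G (centralizer G (x \<otimes> g \<otimes> inv x)) = identity_component G (centralizer G g')"
    using x xG by (intro torus_equiv_identity_component_centralizer) auto
  then show thesis
    using that[OF x(3)] identity_component_centralizer_conj[OF xG x(1)] by simp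
qed

end

theorem lemma3p4:
  fixes G :: "('a, 'k::alg_closed_field) alg_group"
    and C :: "'a set" and g g' :: 'a
  assumes "reductive_group G"
    and "C \<in> strata G"
    and "g \<in> C" and "g' \<in> C"
  shows "conjugate_under G (identity_component G (carrier G))
           (identity_component G (centralizer G g))
           (identity_component G (centralizer G g'))"
proof -
  interpret reductive_group G by fact
  \<comment> \<open>A class of the quotient is the image of one representative \<open>h\<close>,
    with which both elements are compared.\<close>
  obtain h where C: "C = stratum_rel G `` {h}"
    using assms(2) unfolding strata_def by (blast elim: quotientE)
  let ?Z = "\<lambda>y. identity_component G (centralizer G y)"
  obtain x where x: "x \<in> identity_component G (carrier G)"
      "?Z g = (\<lambda>a. x \<otimes>\<^bsub>G\<^esub> a \<otimes>\<^bsub>G\<^esub> inv\<^bsub>G\<^esub> x) ` ?Z h"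
    using stratum_rel_conjugate[of h g] assms(3) unfolding C by blast
  obtain y where y: "y \<in> identity_component G (carrier G)"
      "?Z g' = (\<lambda>a. y \<otimes>\<^bsub>G\<^esub> a \<otimes>\<^bsub>G\<^esub> inv\<^bsub>G\<^esub> y) ` ?Z h"
    using stratum_rel_conjugate[of h g'] assms(4) unfolding C by blast
  have xy: "x \<in> carrier G" "y \<in> carrier G"
    using x(1) y(1) identity_component_subset(2) by blast+
  \<comment> \<open>Conjugation by \<open>z\<close> first undoes \<open>x\<close>, returning to the
    group of \<open>h\<close>, and then applies \<open>y\<close>.\<close>
  define z where "z = y \<otimes>\<^bsub>G\<^esub> inv\<^bsub>G\<^esub> x"
  have "z \<in> identity_component G (carrier G)"
    unfolding z_def by (intro identity_component_mult identity_component_inv x(1) y(1))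
  moreover have "?Z g' = (\<lambda>a. z \<otimes>\<^bsub>G\<^esub> a \<otimes>\<^bsub>G\<^esub> inv\<^bsub>G\<^esub> z) ` ?Z g"
    unfolding x(2) y(2) image_image
  proof (rule image_cong[OF refl])
    fix a assume "a \<in> ?Z h"
    then have "a \<in> carrier G" using identity_component_subset(2) by blast
    then show "y \<otimes>\<^bsub>G\<^esub> a \<otimes>\<^bsub>G\<^esub> inv\<^bsub>G\<^esub> y
        = z \<otimes>\<^bsub>G\<^esub> (x \<otimes>\<^bsub>G\<^esub> a \<otimes>\<^bsub>G\<^esub> inv\<^bsub>G\<^esub> x) \<otimes>\<^bsub>G\<^esub> inv\<^bsub>G\<^esub> z"
      using xy by (simp add: z_def m_assoc inv_mult_group)
  qed
  ultimately show ?thesis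
    unfolding conjugate_under_def by blast
qed

end
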